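(* Let $n$ be a positive integer. Then the following bounds hold for $\mathrm{val}_{\mathcal{Q}}$. (1) Bounded-size sets: for every integer $1\le k\le n$, if $\mathcal{Q}=\{S\subseteq[n]:|S|\le k\}$, then $\mathrm{val}_{\mathcal{Q}}=\Theta(n/\sqrt{k})$. (2) Contiguous blocks: if $\mathcal{Q}=\{[i,j]: i\le j\in[n]\}$, then $\mathrm{val}_{\mathcal{Q}}=\widetilde{\Theta}(n)$. (3) Prefixes: if $\mathcal{Q}=\{[1,i]: i\in[n]\}$, then $\mathrm{val}_{\mathcal{Q}}=\Theta(n)$. (4) Only the full set: if $\mathcal{Q}=\{[n]\}$, then $\mathrm{val}_{\mathcal{Q}}=2^{(n-1)/2}$. Here the constants implicit in $\Theta$ are absolute (independent of $n$ and $k$), and $\widetilde\Theta$ hides factors polylogarithmic in $n$.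
   Context: $[n]=\{1,\dots,n\}$, $[i,j]=\{m\in[n]: i\le m\le j\}$, $\bar S=[n]\setminus S$. A function $f:\{-1,1\}^n\to\mathbb{R}$ is odd if $f(-x)=-f(x)$ for all $x$; $\|f\|_\infty=\max_x|f(x)|$. For $S\subseteq[n]$ and $b\in\{-1,1\}^{\bar S}$, $f_{S|b}:\{-1,1\}^S\to\mathbb{R}$ is the restriction of $f$ obtained by fixing the coordinates in $\bar S$ to $b$. $\mathrm{Var}(g)$ is the variance of $g(\mathbf{x})$ for $\mathbf{x}$ uniform on the domain of $g$. For $\mathcal{Q}\subseteq 2^{[n]}$, $$\mathrm{val}_{\mathcal{Q}} := \max_{\substack{f : \{-1,1\}^n \to \mathbb{R}\\ f \text{ odd},\ f\not\equiv 0}} \frac{\|f\|_\infty}{\max\limits_{S \in \mathcal{Q},\ b \in \{-1,1\}^{\bar{S}}}\sqrt{\mathrm{Var}(f_{S|b})}}.$$ *)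

theory Defs
  imports "HOL-Probability.Probability"
begin

text \<open>
  A function on \<open>{-1,1}\<^sup>S\<close> is represented by a HOL function on \<^typ>\<open>nat \<Rightarrow> real\<close>; only its
  values on \<open>cube S\<close> are ever used. Points of \<open>cube S\<close> are \<^const>\<open>undefined\<close> outside \<open>S\<close>, so
  \<open>cube S\<close> is finite for finite \<open>S\<close>.
\<close>

definition cube :: "nat set \<Rightarrow> (nat \<Rightarrow> real) set" where
  "cube S = S \<rightarrow>\<^sub>E {-1, 1}"

definition odd_fun :: "nat \<Rightarrow> ((nat \<Rightarrow> real) \<Rightarrow> real) \<Rightarrow> bool" where
  "odd_fun n f \<longleftrightarrow> (\<forall>x\<in>cube {1..n}. f (\<lambda>i\<in>{1..n}. - x i) = - f x)"

definition sup_norm :: "nat \<Rightarrow> ((nat \<Rightarrow> real) \<Rightarrow> real) \<Rightarrow> real" where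
  "sup_norm n f = Max ((\<lambda>x. \<bar>f x\<bar>) ` cube {1..n})"

definition restr ::
    "nat \<Rightarrow> ((nat \<Rightarrow> real) \<Rightarrow> real) \<Rightarrow> nat set \<Rightarrow> (nat \<Rightarrow> real) \<Rightarrow> (nat \<Rightarrow> real) \<Rightarrow> real" where
  "restr n f S b = (\<lambda>y. f (merge S ({1..n} - S) (y, b)))"

definition cube_var :: "nat set \<Rightarrow> ((nat \<Rightarrow> real) \<Rightarrow> real) \<Rightarrow> real" where
  "cube_var S g = measure_pmf.variance (pmf_of_set (cube S)) g"

definition max_sd :: "nat \<Rightarrow> nat set set \<Rightarrow> ((nat \<Rightarrow> real) \<Rightarrow> real) \<Rightarrow> real" where
  "max_sd n Q f = Max {sqrt (cube_var S (restr n f S b)) | S b. S \<in> Q \<and> b \<in> cube ({1..n} - S)}"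

text \<open>
  The operator \<open>GREATEST\<close> yields the maximum only if it is attained, and is otherwise unspecified.
  The quotient is meaningful for families \<open>Q\<close> of subsets of \<open>{1..n}\<close> such that \<open>max_sd n Q f > 0\<close>
  for every odd \<open>f\<close> that is not identically zero, for example if \<open>Q\<close> contains \<open>{1..n}\<close> or all
  singletons.
\<close>

definition val :: "nat \<Rightarrow> nat set set \<Rightarrow> real" where
  "val n Q = (GREATEST r. \<exists>f. odd_fun n f \<and> (\<exists>x\<in>cube {1..n}. f x \<noteq> 0) \<and>
     r = sup_norm n f / max_sd n Q f)"

end

theory Submission
  imports Defs
begin

text \<open>
  Upper bounds: write \<open>A U\<close> for the average of \<open>f\<close> over the coordinates in \<open>U\<close>, with the other
  coordinates taken from \<open>x\<close>, so that \<open>A {} = f x\<close> and, as \<open>f\<close> is odd, \<open>A {1..n} = 0\<close>. Removing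
  \<open>i\<close> from \<open>U\<close> changes the average by \<open>x i\<close> times the degree-one Fourier coefficient at \<open>i\<close> of the
  restriction to \<open>U\<close>. If all restrictions to a set \<open>S\<close> with \<open>B \<subseteq> S \<subseteq> U\<close> have standard deviation at most
  \<open>\<sigma>\<close>, then by Cauchy--Schwarz these coefficients, times the signs \<open>x i\<close>, sum to at most
  \<open>\<sigma> sqrt |B|\<close> over \<open>B\<close>, so some \<open>i \<in> B\<close> costs at most \<open>\<sigma> / sqrt |B|\<close>. Prefixes use
  \<open>S = U = {1..u}\<close> and \<open>B = {u}\<close>; sets of size at most \<open>k\<close> use any \<open>B = S\<close> of size \<open>min |U| k\<close>.
  Intervals include the prefixes.

  Lower bounds: the sum of the coordinates (bounded size); the signed length of the final constant
  run (prefixes); the signed number of constant blocks in a partition into blocks of length about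
  \<open>2 log n\<close> (intervals: at most two blocks are cut by an interval, and the blocks inside it
  are rarely constant); the sign of constant vectors (full set).
\<close>

section \<open>Averages and variances on the cube\<close>

definition cube_avg :: "nat set \<Rightarrow> ((nat \<Rightarrow> real) \<Rightarrow> real) \<Rightarrow> real" where
  "cube_avg S g = (\<Sum>y\<in>cube S. g y) / 2 ^ card S"

lemma finite_cube [simp]: "finite S \<Longrightarrow> finite (cube S)"
  by (simp add: cube_def finite_PiE)

lemma cube_nonempty [simp]: "cube S \<noteq> {}"
  by (simp add: cube_def PiE_eq_empty_iff)

lemma card_cube: "finite S \<Longrightarrow> card (cube S) = 2 ^ card S"
  by (simp add: cube_def card_PiE flip: numeral_2_eq_2)

lemma cube_sq: "y \<in> cube S \<Longrightarrow> i \<in> S \<Longrightarrow> y i * y i = 1"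
  unfolding cube_def by (drule PiE_mem) auto

lemma cube_cases: "y \<in> cube S \<Longrightarrow> i \<in> S \<Longrightarrow> y i = 1 \<or> y i = -1"
  unfolding cube_def by (drule PiE_mem) auto

lemma merge_cube:
  assumes "w \<in> cube A" "\<And>i. i \<in> B - A \<Longrightarrow> z i = 1 \<or> z i = -1"
  shows "merge A B (w, z) \<in> cube (A \<union> B)"
  using assms unfolding cube_def by (auto simp: merge_def PiE_iff extensional_def)

lemma cube_neg: "x \<in> cube S \<Longrightarrow> (\<lambda>i\<in>S. - x i) \<in> cube S"
  by (auto simp: cube_def PiE_iff)

lemma cube_neg_neg: "x \<in> cube S \<Longrightarrow> (\<lambda>i\<in>S. - (\<lambda>i\<in>S. - x i) i) = x"
  by (auto simp: cube_def PiE_iff extensional_def fun_eq_iff)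

lemma cube_avg_mono:
  "(\<And>y. y \<in> cube S \<Longrightarrow> g y \<le> h y) \<Longrightarrow> cube_avg S g \<le> cube_avg S h"
  unfolding cube_avg_def by (intro divide_right_mono sum_mono) auto

lemma cube_avg_cong:
  "(\<And>y. y \<in> cube S \<Longrightarrow> g y = h y) \<Longrightarrow> cube_avg S g = cube_avg S h"
  unfolding cube_avg_def by (simp cong: sum.cong)

lemma cube_avg_add: "cube_avg S (\<lambda>y. g y + h y) = cube_avg S g + cube_avg S h"
  by (simp add: cube_avg_def sum.distrib add_divide_distrib)

lemma cube_avg_cmult: "cube_avg S (\<lambda>y. c * g y) = c * cube_avg S g"
  by (simp add: cube_avg_def flip: sum_distrib_left)

lemma cube_avg_diff: "cube_avg S (\<lambda>y. g y - h y) = cube_avg S g - cube_avg S h"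
  by (simp add: cube_avg_def sum_subtractf diff_divide_distrib)

lemma cube_avg_const [simp]: "finite S \<Longrightarrow> cube_avg S (\<lambda>y. c) = c"
  by (simp add: cube_avg_def card_cube)

lemma cube_avg_sum: "cube_avg S (\<lambda>y. \<Sum>i\<in>I. g i y) = (\<Sum>i\<in>I. cube_avg S (g i))"
  unfolding cube_avg_def by (subst sum.swap) (simp add: sum_divide_distrib)

lemma cube_avg_nonneg: "(\<And>y. y \<in> cube S \<Longrightarrow> 0 \<le> g y) \<Longrightarrow> 0 \<le> cube_avg S g"
  unfolding cube_avg_def by (intro divide_nonneg_nonneg sum_nonneg) auto

lemma cube_var_eq:
  assumes "finite S"
  shows "cube_var S g = cube_avg S (\<lambda>y. (g y - cube_avg S g)\<^sup>2)"
  unfolding cube_var_def cube_avg_def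
  by (simp add: integral_pmf_of_set card_cube assms)

lemma cube_var_nonneg: "finite S \<Longrightarrow> 0 \<le> cube_var S g"
  by (simp add: cube_var_eq cube_avg_nonneg)

text \<open>Expanding around the mean leaves the excess \<open>(?m - c)\<^sup>2\<close>. The lower
  bounds use this to avoid computing the means of restrictions: any convenient \<open>c\<close> will
  do.\<close>

lemma cube_var_le:
  assumes "finite S"
  shows "cube_var S g \<le> cube_avg S (\<lambda>y. (g y - c)\<^sup>2)"
proof -
  let ?m = "cube_avg S g"
  have "cube_avg S (\<lambda>y. (g y - c)\<^sup>2) =
      cube_avg S (\<lambda>y. (g y - ?m)\<^sup>2 + (2 * (?m - c) * (g y - ?m) + (?m - c)\<^sup>2))"
    by (intro cube_avg_cong) (simp add: power2_eq_square algebra_simps)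
  also have "\<dots> = cube_var S g + (?m - c)\<^sup>2"
    by (simp only: cube_avg_add cube_avg_cmult cube_avg_diff cube_avg_const[OF assms]
      cube_var_eq[OF assms])
      simp
  finally show ?thesis by simp
qed

lemma sum_cube_insert:
  assumes "finite U" "i \<notin> U"
  shows "(\<Sum>y\<in>cube (insert i U). g y) = (\<Sum>y\<in>cube U. g (y(i := 1)) + g (y(i := -1)))"
proof -
  have "(\<Sum>y\<in>cube (insert i U). g y) = (\<Sum>(e, y)\<in>{-1, 1} \<times> cube U. g (y(i := e)))"
    unfolding cube_def PiE_insert_eq
    using inj_combinator[OF assms(2), of "\<lambda>_. {-1, 1 :: real}"]
    by (subst sum.reindex) (auto simp: case_prod_unfold)
  also have "\<dots> = (\<Sum>e\<in>{-1, 1}. \<Sum>y\<in>cube U. g (y(i := e)))"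
    by (simp add: sum.cartesian_product)
  finally show ?thesis by (simp add: sum.distrib add.commute)
qed

lemma cube_avg_insert:
  assumes "finite U" "i \<notin> U"
  shows "cube_avg (insert i U) g = cube_avg U (\<lambda>y. (g (y(i := 1)) + g (y(i := -1))) / 2)"
  using assms by (simp add: cube_avg_def sum_cube_insert sum_divide_distrib)

text \<open>Fubini: a point of \<open>cube U\<close> corresponds to the pair of its restrictions to
  \<open>U - S\<close> and \<open>S\<close>.\<close>

lemma cube_avg_split:
  assumes "finite U" "S \<subseteq> U"
  shows "cube_avg U g = cube_avg (U - S) (\<lambda>z. cube_avg S (\<lambda>w. g (merge S (U - S) (w, z))))"
proof -
  have "(\<Sum>y\<in>cube U. g y) =
    (\<Sum>(z, w)\<in>cube (U - S) \<times> cube S. g (merge S (U - S) (w, z)))"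
  proof (rule sum.reindex_bij_witness[where j = "\<lambda>y. (restrict y (U - S), restrict y S)"
          and i = "\<lambda>(z, w). merge S (U - S) (w, z)"])
    have *: "merge S (U - S) (restrict y S, restrict y (U - S)) = y" if "y \<in> cube U" for y
      using that assms by (auto simp: cube_def merge_def PiE_iff extensional_def fun_eq_iff)
    then show "(case (restrict y (U - S), restrict y S) of (z, w) \<Rightarrow> merge S (U - S) (w, z)) = y"
      and "(case (restrict y (U - S), restrict y S) of (z, w) \<Rightarrow> g (merge S (U - S) (w, z))) = g y"
      if "y \<in> cube U" for y using that by auto
    show "(case p of (z, w) \<Rightarrow> merge S (U - S) (w, z)) \<in> cube U"
      if "p \<in> cube (U - S) \<times> cube S" for p
      using that merge_cube[of "snd p" S "U - S" "fst p"] assms cube_cases[of "fst p" "U - S"]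
      by (auto simp: Un_absorb1)
  qed (use assms in \<open>auto simp: cube_def merge_def PiE_iff extensional_def fun_eq_iff\<close>)
  then show ?thesis
    using assms card_mono[of U S]
    by (simp add: cube_avg_def sum.cartesian_product card_Diff_subset finite_subset
        flip: sum_divide_distrib power_add)
qed

text \<open>The hypothesis on \<open>g\<close> says that it ignores coordinate \<open>i\<close>, so
  the contributions of \<open>y i = 1\<close> and \<open>y i = -1\<close> cancel.\<close>

lemma cube_avg_coord_mult:
  assumes "finite S" "i \<in> S" "\<And>y e. g (y(i := e)) = g y"
  shows "cube_avg S (\<lambda>y. y i * g y) = 0"
proof -
  have "S = insert i (S - {i})" using assms by auto
  then have "cube_avg S (\<lambda>y. y i * g y) = cube_avg (insert i (S - {i})) (\<lambda>y. y i * g y)"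
    by simp
  also have "\<dots> = 0"
    using assms by (subst cube_avg_insert) (auto simp: assms(3))
  finally show ?thesis .
qed

lemma cube_avg_coord: "finite S \<Longrightarrow> i \<in> S \<Longrightarrow> cube_avg S (\<lambda>y. y i) = 0"
  using cube_avg_coord_mult[of S i "\<lambda>_. 1"] by simp

text \<open>The coordinates are orthonormal under \<open>cube_avg S\<close>, so this is Parseval for
  a linear form with coefficients of square 1.\<close>

lemma cube_avg_linear_sq:
  assumes "finite S" "B \<subseteq> S" "\<And>i. i \<in> B \<Longrightarrow> a i = 1 \<or> a i = -1"
  shows "cube_avg S (\<lambda>y. (\<Sum>i\<in>B. a i * y i)\<^sup>2) = card B"
proof -
  have fin: "finite B" using assms finite_subset by blast
  have *: "cube_avg S (\<lambda>y. y i * y j) = (if i = j then 1 else 0)" if "i \<in> B" "j \<in> B" for i j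
  proof (cases "i = j")
    case True
    then have "cube_avg S (\<lambda>y. y i * y j) = cube_avg S (\<lambda>y. 1)"
      using that assms by (intro cube_avg_cong) (auto simp: cube_sq)
    with True show ?thesis using assms by simp
  next
    case False
    then show ?thesis
      using cube_avg_coord_mult[of S i "\<lambda>y. y j"] that assms by auto
  qed
  have "cube_avg S (\<lambda>y. (\<Sum>i\<in>B. a i * y i)\<^sup>2) =
      cube_avg S (\<lambda>y. \<Sum>i\<in>B. \<Sum>j\<in>B. a i * a j * (y i * y j))"
    by (simp add: power2_eq_square sum_product algebra_simps)
  also have "\<dots> = (\<Sum>i\<in>B. \<Sum>j\<in>B. a i * a j * (if i = j then 1 else 0))"
    by (simp only: cube_avg_sum cube_avg_cmult) (intro sum.cong refl, simp add: *)
  also have "\<dots> = (\<Sum>i\<in>B. 1)"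
  proof (intro sum.cong refl)
    fix i assume "i \<in> B"
    then show "(\<Sum>j\<in>B. a i * a j * (if i = j then 1 else 0)) = 1"
      using fin assms(3)[of i] by (subst sum.remove[of _ i]) auto
  qed
  finally show ?thesis by simp
qed

lemma cube_avg_Cauchy_Schwarz:
  "cube_avg S (\<lambda>y. g y * h y) \<le>
    sqrt (cube_avg S (\<lambda>y. (g y)\<^sup>2)) * sqrt (cube_avg S (\<lambda>y. (h y)\<^sup>2))"
proof -
  have "(cube_avg S (\<lambda>y. g y * h y))\<^sup>2 \<le>
      cube_avg S (\<lambda>y. (g y)\<^sup>2) * cube_avg S (\<lambda>y. (h y)\<^sup>2)"
    using Cauchy_Schwarz_ineq_sum[of g h "cube S"]
    by (simp add: cube_avg_def power_divide power2_eq_square divide_right_mono)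
  then show ?thesis
    unfolding real_sqrt_mult[symmetric] by (rule real_le_rsqrt)
qed

text \<open>The linear form has mean zero, so \<open>h\<close> may be centred before Cauchy-Schwarz
  is applied; this brings in the variance of \<open>h\<close> instead of its second moment.\<close>

lemma cube_avg_linear_mult_le:
  assumes "finite S" "B \<subseteq> S" "\<And>i. i \<in> B \<Longrightarrow> a i = 1 \<or> a i = -1"
  shows "cube_avg S (\<lambda>y. (\<Sum>i\<in>B. a i * y i) * h y) \<le> sqrt (card B) * sqrt (cube_var S h)"
proof -
  let ?L = "\<lambda>y. \<Sum>i\<in>B. a i * y i" and ?m = "cube_avg S h"
  have 0: "cube_avg S ?L = 0"
    unfolding cube_avg_sum cube_avg_cmult
    using assms by (intro sum.neutral ballI) (auto simp: cube_avg_coord subset_iff)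
  have "cube_avg S (\<lambda>y. ?L y * h y) = cube_avg S (\<lambda>y. ?L y * (h y - ?m) + ?m * ?L y)"
    by (simp add: algebra_simps)
  also have "\<dots> = cube_avg S (\<lambda>y. ?L y * (h y - ?m))"
    by (simp only: cube_avg_add cube_avg_cmult 0)
  also have "\<dots> \<le> sqrt (cube_avg S (\<lambda>y. (?L y)\<^sup>2)) * sqrt (cube_avg S (\<lambda>y. (h y - ?m)\<^sup>2))"
    by (rule cube_avg_Cauchy_Schwarz)
  finally show ?thesis
    using assms by (simp only: cube_avg_linear_sq cube_var_eq)
qed

section \<open>Averages over a block of coordinates\<close>

text \<open>Restrictions compose: once \<open>z\<close> is fixed too, an average over
  \<open>U\<close> becomes an average over \<open>S\<close> of a restriction to
  \<open>S\<close>.\<close>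

lemma restr_merge:
  assumes "S \<subseteq> U" "U \<subseteq> {1..n}"
  shows "restr n f U x (merge S (U - S) (w, z)) =
    restr n f S (merge (U - S) ({1..n} - U) (z, x)) w"
  unfolding restr_def using assms
  by (intro arg_cong[where f = f]) (auto simp: merge_def fun_eq_iff)

text \<open>This is the quantity \<open>A U\<close> of the overview; it depends on \<open>x\<close>
  only outside \<open>U\<close>.\<close>

definition block_avg :: "nat \<Rightarrow> ((nat \<Rightarrow> real) \<Rightarrow> real) \<Rightarrow> nat set \<Rightarrow> (nat \<Rightarrow> real) \<Rightarrow> real" where
  "block_avg n f U x = cube_avg U (restr n f U x)"

lemma block_avg_empty:
  assumes "x \<in> cube {1..n}"
  shows "block_avg n f {} x = f x"
proof -
  have "merge {} {1..n} (y, x) = x" for y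
    using assms by (auto simp: merge_def cube_def PiE_iff extensional_def fun_eq_iff)
  then show ?thesis by (simp add: block_avg_def cube_avg_def cube_def restr_def)
qed

lemma restr_full: "y \<in> cube {1..n} \<Longrightarrow> restr n f {1..n} x y = f y"
  unfolding restr_def
  by (intro arg_cong[where f = f])
    (auto simp: merge_def cube_def PiE_iff extensional_def fun_eq_iff)

text \<open>Negation permutes the cube and flips the sign of \<open>f\<close>, so the sum of
  \<open>f\<close> equals its own negative.\<close>

lemma block_avg_full:
  assumes "odd_fun n f"
  shows "block_avg n f {1..n} x = 0"
proof -
  have "(\<Sum>y\<in>cube {1..n}. f y) = (\<Sum>y\<in>cube {1..n}. f (\<lambda>i\<in>{1..n}. - y i))"
    by (rule sum.reindex_bij_witness[where i = "\<lambda>y. \<lambda>i\<in>{1..n}. - y i"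
          and j = "\<lambda>y. \<lambda>i\<in>{1..n}. - y i"])
       (use cube_neg_neg[of _ "{1..n}"] cube_neg[of _ "{1..n}"] in auto)
  also have "\<dots> = - (\<Sum>y\<in>cube {1..n}. f y)"
    using assms by (simp add: odd_fun_def flip: sum_negf)
  finally have "cube_avg {1..n} f = 0" by (simp add: cube_avg_def)
  then show ?thesis
    unfolding block_avg_def using cube_avg_cong[OF restr_full] by simp
qed

text \<open>The factor \<open>1 + x i * y i\<close> is 2 if \<open>y i = x i\<close> and 0
  otherwise; averaging against it therefore conditions on coordinate \<open>i\<close> having the
  value \<open>x i\<close>.\<close>

lemma block_avg_remove:
  assumes "U \<subseteq> {1..n}" "i \<in> U" "x \<in> cube {1..n}"
  shows "block_avg n f (U - {i}) x - block_avg n f U x =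
    cube_avg U (\<lambda>y. x i * y i * restr n f U x y)"
proof -
  let ?F = "restr n f U x"
  have fin: "finite U" using assms finite_subset by blast
  have U: "U = insert i (U - {i})" using assms by auto
  have xi: "x i = 1 \<or> x i = -1" using assms cube_cases by blast
  have F: "?F (y(i := x i)) = restr n f (U - {i}) x y" for y
    unfolding restr_def using assms
    by (intro arg_cong[where f = f]) (auto simp: merge_def fun_eq_iff)
  have "block_avg n f U x + cube_avg U (\<lambda>y. x i * y i * ?F y) =
      cube_avg (insert i (U - {i})) (\<lambda>y. (1 + x i * y i) * ?F y)"
    using U by (simp add: block_avg_def algebra_simps flip: cube_avg_add)
  also have "\<dots> = cube_avg (U - {i}) (\<lambda>y. ?F (y(i := x i)))"
    using fin xi by (subst cube_avg_insert) auto
  finally show ?thesis by (simp add: F block_avg_def)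
qed

text \<open>If every \<open>i\<close> in \<open>B\<close> cost more than claimed, the total cost
  over \<open>B\<close> would exceed \<open>\<sigma> * sqrt (card B)\<close>. That total is the
  average of a linear form times the restriction, which is bounded after conditioning on
  \<open>U - S\<close>.\<close>

lemma exists_coord_block_avg_le:
  assumes U: "U \<subseteq> {1..n}" and S: "S \<subseteq> U" and B: "B \<subseteq> S" "B \<noteq> {}"
    and x: "x \<in> cube {1..n}"
    and sd: "\<And>b. b \<in> cube ({1..n} - S) \<Longrightarrow> sqrt (cube_var S (restr n f S b)) \<le> \<sigma>"
  shows "\<exists>i\<in>B. block_avg n f (U - {i}) x \<le> block_avg n f U x + \<sigma> / sqrt (card B)"
proof (rule ccontr)
  assume "\<not> ?thesis"
  then have gt: "block_avg n f (U - {i}) x - block_avg n f U x > \<sigma> / sqrt (card B)" if "i \<in> B" for i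
    using that by force
  let ?F = "restr n f U x"
  let ?L = "\<lambda>y. \<Sum>i\<in>B. x i * y i"
  have fin: "finite U" "finite S" "finite B"
    using assms finite_subset by (metis finite_atLeastAtMost)+
  have xi: "x i = 1 \<or> x i = -1" if "i \<in> {1..n}" for i
    using that cube_cases x by blast
  have "(\<Sum>i\<in>B. block_avg n f (U - {i}) x - block_avg n f U x) =
      cube_avg U (\<lambda>y. ?L y * ?F y)"
    using U S B x
    by (subst sum_distrib_right, subst cube_avg_sum, intro sum.cong refl block_avg_remove) auto
  \<comment> \<open>As \<open>B \<subseteq> S\<close>, the linear form depends on \<open>w\<close>
    only and is untouched by conditioning on \<open>z\<close>.\<close>
  also have "\<dots> = cube_avg (U - S) (\<lambda>z. cube_avg S (\<lambda>w. ?L w *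
      restr n f S (merge (U - S) ({1..n} - U) (z, x)) w))"
    unfolding cube_avg_split[OF fin(1) S] restr_merge[OF S U]
  proof (intro cube_avg_cong)
    fix z w
    have "?L (merge S (U - S) (w, z)) = ?L w"
      using B by (intro sum.cong) (auto simp: merge_def)
    then show "?L (merge S (U - S) (w, z)) * restr n f S (merge (U - S) ({1..n} - U) (z, x)) w =
      ?L w * restr n f S (merge (U - S) ({1..n} - U) (z, x)) w" by simp
  qed
  also have "\<dots> \<le> cube_avg (U - S) (\<lambda>z. sqrt (card B) * \<sigma>)"
  proof (intro cube_avg_mono)
    fix z assume z: "z \<in> cube (U - S)"
    let ?b = "merge (U - S) ({1..n} - U) (z, x)"
    have "?b \<in> cube ((U - S) \<union> ({1..n} - U))"
      using z xi by (intro merge_cube) auto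
    also have "(U - S) \<union> ({1..n} - U) = {1..n} - S" using U S by auto
    finally have "sqrt (cube_var S (restr n f S ?b)) \<le> \<sigma>" by (rule sd)
    moreover have "cube_avg S (\<lambda>w. ?L w * restr n f S ?b w) \<le>
        sqrt (card B) * sqrt (cube_var S (restr n f S ?b))"
      using B(1) fin by (intro cube_avg_linear_mult_le xi set_mp[OF U] set_mp[OF S]) auto
    ultimately show "cube_avg S (\<lambda>w. ?L w * restr n f S ?b w) \<le> sqrt (card B) * \<sigma>"
      by (meson mult_left_mono order_trans real_sqrt_ge_zero of_nat_0_le_iff)
  qed
  also have "\<dots> = (\<Sum>i\<in>B. \<sigma> / sqrt (card B))"
    using fin B by (simp add: real_div_sqrt field_simps)
  finally show False
    using sum_strict_mono[OF fin(3) B(2), of "\<lambda>_. \<sigma> / sqrt (card B)"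
        "\<lambda>i. block_avg n f (U - {i}) x - block_avg n f U x"] gt by simp
qed

section \<open>Elementary properties of \<open>max_sd\<close> and \<open>sup_norm\<close>\<close>

lemma max_sd_image:
  "max_sd n Q f = Max ((\<lambda>(S, b). sqrt (cube_var S (restr n f S b))) `
    (SIGMA S:Q. cube ({1..n} - S)))"
  unfolding max_sd_def by (rule arg_cong[where f = Max]) auto

lemma max_sd_ge:
  assumes "finite Q" "S \<in> Q" "b \<in> cube ({1..n} - S)"
  shows "sqrt (cube_var S (restr n f S b)) \<le> max_sd n Q f"
  unfolding max_sd_image using assms by (intro Max_ge) auto

lemma max_sd_le:
  assumes "finite Q" "Q \<noteq> {}"
    "\<And>S b. S \<in> Q \<Longrightarrow> b \<in> cube ({1..n} - S) \<Longrightarrow> sqrt (cube_var S (restr n f S b)) \<le> s"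
  shows "max_sd n Q f \<le> s"
  unfolding max_sd_image using assms by (subst Max_le_iff) (auto simp: Sigma_empty_iff)

lemma max_sd_mono:
  assumes "finite Q" "P \<subseteq> Q" "P \<noteq> {}"
  shows "max_sd n P f \<le> max_sd n Q f"
  using assms finite_subset by (intro max_sd_le max_sd_ge) auto

lemma sup_norm_ge: "x \<in> cube {1..n} \<Longrightarrow> \<bar>f x\<bar> \<le> sup_norm n f"
  unfolding sup_norm_def by (intro Max_ge) auto

lemma sup_norm_attained: "\<exists>x\<in>cube {1..n}. sup_norm n f = \<bar>f x\<bar>"
proof -
  have "sup_norm n f \<in> (\<lambda>x. \<bar>f x\<bar>) ` cube {1..n}"
    unfolding sup_norm_def by (intro Max_in) auto
  then show ?thesis by auto
qed

text \<open>If the maximum of the absolute value occurs at a negative value, the antipodal point has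
  the positive one.\<close>

lemma odd_fun_attains_sup_norm:
  assumes "odd_fun n f"
  shows "\<exists>x\<in>cube {1..n}. f x = sup_norm n f"
proof -
  obtain x where x: "x \<in> cube {1..n}" "sup_norm n f = \<bar>f x\<bar>"
    using sup_norm_attained by blast
  then have "f (\<lambda>i\<in>{1..n}. - x i) = - f x" "(\<lambda>i\<in>{1..n}. - x i) \<in> cube {1..n}"
    using assms cube_neg unfolding odd_fun_def by blast+
  then show ?thesis using x by (metis abs_if)
qed

section \<open>Attainment of the maximum in \<open>val\<close>\<close>

lemma continuous_on_Max_image:
  fixes h :: "'i \<Rightarrow> 'a::topological_space \<Rightarrow> real"
  assumes "finite I" "I \<noteq> {}" "\<And>i. i \<in> I \<Longrightarrow> continuous_on K (h i)"
  shows "continuous_on K (\<lambda>x. Max ((\<lambda>i. h i x) ` I))"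
  using assms by (induction I rule: finite_ne_induct) (auto intro: continuous_on_max)

text \<open>In the product topology evaluation at a point is continuous, and \<open>max_sd\<close>
  is a finite maximum of continuous expressions in finitely many values of \<open>f\<close>.\<close>

lemma continuous_on_max_sd:
  assumes "finite Q" "Q \<noteq> {}" "Q \<subseteq> Pow {1..n}"
  shows "continuous_on K (\<lambda>f. max_sd n Q f)"
proof -
  have "continuous_on K (\<lambda>f. sqrt (cube_var S (restr n f S b)))" if "S \<in> Q" for S b
  proof -
    have "finite S" using that assms finite_subset by blast
    moreover have "continuous_on K (\<lambda>f :: (nat \<Rightarrow> real) \<Rightarrow> real. f x)" for x
      by (rule continuous_on_subset[OF continuous_on_product_coordinates]) simp
    ultimately show ?thesis
      unfolding cube_var_eq[OF \<open>finite S\<close>] cube_avg_def restr_def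
      by (intro continuous_intros) auto
  qed
  then show ?thesis
    unfolding max_sd_image using assms
    by (intro continuous_on_Max_image) (auto simp: Sigma_empty_iff)
qed

text \<open>Proportionality is demanded on the cube only, because the rescaled function in
  \<open>exists_extremal\<close> is cut off to 0 elsewhere.\<close>

lemma cube_var_cmult:
  assumes "finite S" "\<And>y. y \<in> cube S \<Longrightarrow> h y = c * g y"
  shows "cube_var S h = c\<^sup>2 * cube_var S g"
proof -
  have "cube_avg S h = c * cube_avg S g"
    using cube_avg_cong[OF assms(2)] by (simp add: cube_avg_cmult)
  then have "cube_var S h = cube_avg S (\<lambda>y. c\<^sup>2 * (g y - cube_avg S g)\<^sup>2)"
    unfolding cube_var_eq[OF assms(1)]
    by (intro cube_avg_cong) (simp add: assms(2) power2_eq_square algebra_simps)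
  then show ?thesis by (simp add: cube_avg_cmult cube_var_eq assms)
qed

lemma merge_restr_cube:
  assumes "y \<in> cube S" "b \<in> cube ({1..n} - S)" "S \<subseteq> {1..n}"
  shows "merge S ({1..n} - S) (y, b) \<in> cube {1..n}"
  using merge_cube[of y S "{1..n} - S" b] assms cube_cases[of b "{1..n} - S"]
  by (auto simp: Un_absorb1)

text \<open>\<open>GREATEST\<close> calls for an attained maximum. The quotient is invariant under
  positive scaling, so it suffices to minimise the continuous \<open>max_sd\<close> over the odd
  functions of sup norm 1, which form a compact set.\<close>

lemma exists_extremal:
  assumes Q: "finite Q" "Q \<noteq> {}" "Q \<subseteq> Pow {1..n}"
    and pos: "\<And>f. odd_fun n f \<Longrightarrow> \<exists>x\<in>cube {1..n}. f x \<noteq> 0 \<Longrightarrow> 0 < max_sd n Q f"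
    and ex: "odd_fun n f0" "\<exists>x\<in>cube {1..n}. f0 x \<noteq> 0"
  shows "\<exists>f. odd_fun n f \<and> (\<exists>x\<in>cube {1..n}. f x \<noteq> 0) \<and>
    (\<forall>g. odd_fun n g \<and> (\<exists>x\<in>cube {1..n}. g x \<noteq> 0) \<longrightarrow>
      sup_norm n g / max_sd n Q g \<le> sup_norm n f / max_sd n Q f)"
proof -
  define C where "C = cube {1..n}"
  define neg where "neg x = (\<lambda>i\<in>{1..n}. - x i :: real)" for x
  \<comment> \<open>Forcing the value 0 off the cube makes \<open>D\<close> a product of compact
    sets, so that Tychonoff applies to functions on the whole type.\<close>
  define D where "D = (PiE UNIV (\<lambda>x. if x \<in> C then {-1..1} else {0::real}))"
  \<comment> \<open>Within \<open>D\<close>, sup norm 1 means for an odd function that the value 1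
    is taken on the cube. This is a closed condition, being a finite union of closed ones.\<close>
  define K where "K = D \<inter> ((\<Inter>x\<in>C. {f. f (neg x) = - f x}) \<inter> (\<Union>x\<in>C. {f. f x = 1}))"
  have eval: "continuous_on UNIV (\<lambda>f :: (nat \<Rightarrow> real) \<Rightarrow> real. f x)" for x
    by simp
  have "compactin (product_topology (\<lambda>_. euclidean) UNIV) D"
    unfolding D_def compactin_PiE by simp
  then have "compact D"
    by (simp add: euclidean_product_topology)
  moreover have "closed (\<Inter>x\<in>C. {f :: (nat \<Rightarrow> real) \<Rightarrow> real. f (neg x) = - f x})"
    by (intro closed_INT ballI closed_Collect_eq continuous_intros eval)
  moreover have "closed (\<Union>x\<in>C. {f :: (nat \<Rightarrow> real) \<Rightarrow> real. f x = 1})"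
    by (intro closed_UN ballI closed_Collect_eq continuous_intros eval) (simp add: C_def)
  ultimately have "compact K"
    unfolding K_def by (intro compact_Int_closed closed_Int)
  have normalize: "\<exists>h\<in>K. max_sd n Q h \<le> max_sd n Q g / sup_norm n g"
    and sup_pos: "0 < sup_norm n g"
    if g: "odd_fun n g" "\<exists>x\<in>cube {1..n}. g x \<noteq> 0" for g
  proof -
    let ?N = "sup_norm n g"
    obtain x where x: "x \<in> C" "g x \<noteq> 0" using g C_def by auto
    then show N: "0 < ?N" using sup_norm_ge[of x n g] C_def by auto
    define h where "h y = (if y \<in> C then g y / ?N else 0)" for y
    have le: "\<bar>g y\<bar> \<le> ?N" if "y \<in> C" for y
      using sup_norm_ge that C_def by blast
    obtain z where z: "z \<in> C" "g z = ?N"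
      using odd_fun_attains_sup_norm[OF g(1)] C_def by auto
    have "h y \<in> {-1..1}" if "y \<in> C" for y
      using N le[OF that] that by (simp add: h_def divide_simps abs_le_iff)
    then have "h \<in> D" unfolding D_def by (auto simp: h_def)
    moreover have "h (neg y) = - h y" if "y \<in> C" for y
      using g(1) that cube_neg[of y "{1..n}"] unfolding h_def odd_fun_def neg_def C_def by simp
    moreover have "h z = 1" using z N by (simp add: h_def)
    ultimately have "h \<in> K" using z(1) unfolding K_def by auto
    moreover have "max_sd n Q h \<le> max_sd n Q g / ?N"
    proof (rule max_sd_le[OF Q(1,2)])
      fix S b assume S: "S \<in> Q" "b \<in> cube ({1..n} - S)"
      then have "S \<subseteq> {1..n}" "finite S" using Q finite_subset by blast+
      then have "cube_var S (restr n h S b) = (1 / ?N)\<^sup>2 * cube_var S (restr n g S b)"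
        using S merge_restr_cube
        by (intro cube_var_cmult) (auto simp: restr_def h_def C_def)
      then have "sqrt (cube_var S (restr n h S b)) = sqrt (cube_var S (restr n g S b)) / ?N"
        using N by (simp add: real_sqrt_mult real_sqrt_divide power_divide)
      then show "sqrt (cube_var S (restr n h S b)) \<le> max_sd n Q g / ?N"
        using max_sd_ge[OF Q(1) S] N by (simp add: divide_right_mono)
    qed
    ultimately show "\<exists>h\<in>K. max_sd n Q h \<le> max_sd n Q g / ?N" by blast
  qed
  have "K \<noteq> {}" using normalize[OF ex] by blast
  then obtain f where f: "f \<in> K" "\<And>h. h \<in> K \<Longrightarrow> max_sd n Q f \<le> max_sd n Q h"
    using continuous_attains_inf[OF \<open>compact K\<close> _ continuous_on_max_sd[OF Q]] by blast
  have odd: "odd_fun n f" and nz: "\<exists>x\<in>cube {1..n}. f x \<noteq> 0"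
    using f(1) unfolding K_def odd_fun_def neg_def C_def by force+
  have "1 \<le> sup_norm n f"
    using f(1) sup_norm_ge[of _ n f] unfolding K_def C_def by force
  have "sup_norm n g / max_sd n Q g \<le> sup_norm n f / max_sd n Q f"
    if g: "odd_fun n g" "\<exists>x\<in>cube {1..n}. g x \<noteq> 0" for g
  proof -
    obtain h where "h \<in> K" "max_sd n Q h \<le> max_sd n Q g / sup_norm n g"
      using normalize[OF g] by blast
    then have "max_sd n Q f \<le> max_sd n Q g / sup_norm n g" using f(2) by force
    then have "sup_norm n g / max_sd n Q g \<le> 1 / max_sd n Q f"
      using sup_pos[OF g] pos[OF g] pos[OF odd nz] by (simp add: field_simps)
    also have "\<dots> \<le> sup_norm n f / max_sd n Q f"
      using \<open>1 \<le> sup_norm n f\<close> pos[OF odd nz] by (intro divide_right_mono) auto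
    finally show ?thesis .
  qed
  with odd nz show ?thesis by blast
qed

text \<open>Common frame of all four cases: \<open>upper\<close> bounds every quotient, and
  \<open>f0\<close> is a witness with value at least \<open>m\<close> and standard deviations at
  most \<open>s\<close>. Moreover \<open>upper\<close> forces \<open>max_sd\<close> to be positive
  on nonzero odd functions, which makes the quotients meaningful.\<close>

lemma val_bounds:
  assumes Q: "finite Q" "Q \<noteq> {}" "Q \<subseteq> Pow {1..n}"
    and upper: "\<And>f. odd_fun n f \<Longrightarrow> sup_norm n f \<le> C * max_sd n Q f" and "0 \<le> C"
    and f0: "odd_fun n f0" "x0 \<in> cube {1..n}" "m \<le> f0 x0" "0 < m"
    and sd: "\<And>S b. S \<in> Q \<Longrightarrow> b \<in> cube ({1..n} - S) \<Longrightarrow> cube_var S (restr n f0 S b) \<le> s\<^sup>2"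
    and "0 \<le> s"
  shows "m / s \<le> val n Q \<and> val n Q \<le> C"
proof -
  let ?R = "\<lambda>r. \<exists>f. odd_fun n f \<and> (\<exists>x\<in>cube {1..n}. f x \<noteq> 0) \<and> r = sup_norm n f / max_sd n Q f"
  have pos: "0 < max_sd n Q f" if f: "odd_fun n f" "\<exists>x\<in>cube {1..n}. f x \<noteq> 0" for f
  proof -
    obtain x where "x \<in> cube {1..n}" "f x \<noteq> 0" using f by blast
    then have "0 < C * max_sd n Q f" using upper[OF f(1)] sup_norm_ge[of x n f] by linarith
    then show ?thesis using \<open>0 \<le> C\<close> by (simp add: zero_less_mult_iff)
  qed
  have nz: "\<exists>x\<in>cube {1..n}. f0 x \<noteq> 0" using f0 by force
  obtain f where f: "odd_fun n f" "\<exists>x\<in>cube {1..n}. f x \<noteq> 0"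
    and max: "\<And>g. odd_fun n g \<Longrightarrow> \<exists>x\<in>cube {1..n}. g x \<noteq> 0 \<Longrightarrow>
      sup_norm n g / max_sd n Q g \<le> sup_norm n f / max_sd n Q f"
    using exists_extremal[OF Q pos f0(1) nz] by blast
  have val: "val n Q = sup_norm n f / max_sd n Q f"
    unfolding val_def using f max by (intro Greatest_equality) blast+
  have "max_sd n Q f0 \<le> s"
    using sd \<open>0 \<le> s\<close> by (intro max_sd_le Q) (simp add: real_le_lsqrt)
  moreover have "m \<le> sup_norm n f0" using sup_norm_ge[OF f0(2), of f0] f0(3) by linarith
  ultimately have "m / s \<le> sup_norm n f0 / max_sd n Q f0"
    using pos[OF f0(1) nz] f0(4) by (intro frac_le) auto
  also have "\<dots> \<le> val n Q" using max[OF f0(1) nz] val by simp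
  finally show ?thesis
    using val upper[OF f(1)] pos[OF f] by (simp add: pos_divide_le_eq)
qed

section \<open>Upper bounds\<close>

text \<open>Coordinates are removed one at a time until \<open>U\<close> is empty, where the average
  is \<open>f x\<close>; the costs add up. The invariant \<open>P\<close> keeps \<open>U\<close> of
  a shape to which the family applies.\<close>

lemma descent:
  assumes x: "x \<in> cube {1..n}"
    and step: "\<And>U. P U \<Longrightarrow> U \<noteq> {} \<Longrightarrow> \<exists>i\<in>U. P (U - {i}) \<and>
      block_avg n f (U - {i}) x \<le> block_avg n f U x + \<delta> (card U)"
    and "finite U" "P U"
  shows "f x \<le> block_avg n f U x + (\<Sum>u=1..card U. \<delta> u)"
  using assms(3,4)
proof (induction "card U" arbitrary: U)
  case 0
  then show ?case using x by (simp add: block_avg_empty)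
next
  case (Suc m)
  then obtain i where i: "i \<in> U" "P (U - {i})"
    "block_avg n f (U - {i}) x \<le> block_avg n f U x + \<delta> (card U)"
    using step[of U] by fastforce
  have "f x \<le> block_avg n f (U - {i}) x + (\<Sum>u=1..m. \<delta> u)"
  proof -
    have "m = card (U - {i})" using Suc.hyps(2) Suc.prems i by simp
    then show ?thesis using Suc.hyps(1)[of "U - {i}"] Suc.prems i by simp
  qed
  then show ?case using i(3) by (simp flip: Suc.hyps(2))
qed

lemma sup_norm_le_prefixes:
  assumes odd: "odd_fun n f" and n: "1 \<le> n"
  shows "sup_norm n f \<le> real n * max_sd n {{1..i} | i. i \<in> {1..n}} f"
proof -
  let ?Q = "{{1..i} | i. i \<in> {1..n}}"
  obtain x where x: "x \<in> cube {1..n}" "f x = sup_norm n f"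
    using odd_fun_attains_sup_norm[OF odd] by blast
  have "f x \<le> block_avg n f {1..n} x + (\<Sum>u=1..card {1..n}. max_sd n ?Q f)"
  \<comment> \<open>The case \<open>u = 0\<close> is included, since the descent ends at the empty
    prefix.\<close>
  proof (rule descent[where P = "\<lambda>U. \<exists>u\<le>n. U = {1..u}", OF x(1)])
    fix U :: "nat set" assume "\<exists>u\<le>n. U = {1..u}" "U \<noteq> {}"
    then obtain u where u: "u \<le> n" "U = {1..u}" "1 \<le> u" by auto
    have "\<exists>i\<in>{u}. block_avg n f (U - {i}) x \<le>
        block_avg n f U x + max_sd n ?Q f / sqrt (card {u})"
      using u x by (intro exists_coord_block_avg_le[where S = U] max_sd_ge) auto
    moreover have "{1..u} - {u} = {1..u - 1}" by auto
    ultimately show "\<exists>i\<in>U. (\<exists>u\<le>n. U - {i} = {1..u}) \<and>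
        block_avg n f (U - {i}) x \<le> block_avg n f U x + max_sd n ?Q f"
      using u by (intro bexI[of _ u] conjI exI[of _ "u - 1"]) auto
  qed auto
  then show ?thesis using x block_avg_full[OF odd] by simp
qed

text \<open>Telescoping: by the arithmetic-geometric mean inequality each term is at most the
  increment of \<open>2 * sqrt k\<close>.\<close>

lemma sum_inverse_sqrt_le: "(\<Sum>u=1..k. 1 / sqrt (real u)) \<le> 2 * sqrt (real k)"
proof (induction k)
  case (Suc k)
  have "1 / sqrt (real (Suc k)) \<le> 2 * sqrt (real (Suc k)) - 2 * sqrt (real k)"
  proof -
    have "2 * (sqrt (real (Suc k)) * sqrt (real k)) \<le> real (Suc k) + real k"
      using arith_geo_mean_sqrt[of "real (Suc k)" "real k"] by (simp add: real_sqrt_mult)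
    then show ?thesis by (simp add: field_simps)
  qed
  with Suc show ?case by simp
qed simp

text \<open>Charging \<open>1 / sqrt k\<close> to every \<open>u\<close> gives one copy of
  \<open>n / sqrt k\<close>. The small \<open>u\<close> add at most \<open>2 * sqrt k\<close>, hence
  at most two more copies as \<open>k \<le> n\<close>.\<close>

lemma sum_inverse_sqrt_min_le:
  assumes "1 \<le> k" "k \<le> n"
  shows "(\<Sum>u=1..n. 1 / sqrt (real (min u k))) \<le> 3 * (real n / sqrt (real k))"
proof -
  have "(\<Sum>u=1..n. 1 / sqrt (real (min u k))) \<le>
      (\<Sum>u=1..n. 1 / sqrt (real k) + (if u \<in> {1..k} then 1 / sqrt (real u) else 0))"
    by (intro sum_mono) (auto simp: min_def)
  also have "\<dots> = real n / sqrt (real k) + (\<Sum>u=1..k. 1 / sqrt (real u))"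
    using assms unfolding sum.distrib sum.inter_restrict[OF finite_atLeastAtMost, symmetric]
    by (simp add: Int_absorb1)
  also have "\<dots> \<le> real n / sqrt (real k) + 2 * sqrt (real k)"
    using sum_inverse_sqrt_le[of k] by simp
  finally have "(\<Sum>u=1..n. 1 / sqrt (real (min u k))) \<le>
      real n / sqrt (real k) + 2 * sqrt (real k)" .
  moreover have "real k / sqrt (real k) \<le> real n / sqrt (real k)"
    using assms by (intro divide_right_mono) auto
  ultimately show ?thesis by (simp add: real_div_sqrt)
qed

lemma sup_norm_le_bounded_sets:
  assumes odd: "odd_fun n f" and k: "1 \<le> k" "k \<le> n"
  shows "sup_norm n f \<le> 3 * (real n / sqrt (real k)) * max_sd n {S. S \<subseteq> {1..n} \<and> card S \<le> k} f"
proof -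
  let ?Q = "{S. S \<subseteq> {1..n} \<and> card S \<le> k}"
  have fin: "finite ?Q" by (rule finite_subset[of _ "Pow {1..n}"]) auto
  obtain x where x: "x \<in> cube {1..n}" "f x = sup_norm n f"
    using odd_fun_attains_sup_norm[OF odd] by blast
  have "f x \<le> block_avg n f {1..n} x +
      (\<Sum>u=1..card {1..n}. max_sd n ?Q f / sqrt (real (min u k)))"
  proof (rule descent[where P = "\<lambda>U. U \<subseteq> {1..n}", OF x(1)])
    fix U assume U: "U \<subseteq> {1..n}" "U \<noteq> {}"
    obtain B where B: "B \<subseteq> U" "card B = min (card U) k"
      by (meson min.cobounded1 obtain_subset_with_card_n)
    moreover have "0 < card U" using U finite_subset by (auto simp: card_gt_0_iff)
    ultimately have "B \<noteq> {}" using k by auto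
    then have "\<exists>i\<in>B. block_avg n f (U - {i}) x \<le>
        block_avg n f U x + max_sd n ?Q f / sqrt (card B)"
      using U B x by (intro exists_coord_block_avg_le[where S = B] max_sd_ge fin) auto
    then show "\<exists>i\<in>U. U - {i} \<subseteq> {1..n} \<and> block_avg n f (U - {i}) x \<le>
        block_avg n f U x + max_sd n ?Q f / sqrt (real (min (card U) k))"
      using B U by auto
  qed auto
  also have "(\<Sum>u=1..card {1..n}. max_sd n ?Q f / sqrt (real (min u k))) =
      max_sd n ?Q f * (\<Sum>u=1..n. 1 / sqrt (real (min u k)))"
    by (simp add: sum_distrib_left)
  also have "\<dots> \<le> max_sd n ?Q f * (3 * (real n / sqrt (real k)))"
  proof (intro mult_left_mono sum_inverse_sqrt_min_le k)
    \<comment> \<open>The empty set belongs to the family, so the maximum dominates the square root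
      of a variance.\<close>
    show "0 \<le> max_sd n ?Q f"
      using max_sd_ge[OF fin, of "{}" x n f] x(1) cube_var_nonneg[of "{}" "restr n f {} x"]
      by (auto intro: order_trans[rotated])
  qed
  finally show ?thesis using x block_avg_full[OF odd] by (simp add: mult.commute)
qed

text \<open>The mean is zero, so the variance is the second moment, to which a maximiser and its
  antipode alone contribute \<open>2 * (f x)\<^sup>2 / 2 ^ n\<close>.\<close>

lemma sup_norm_le_full:
  assumes odd: "odd_fun n f" and n: "1 \<le> n"
  shows "sup_norm n f \<le> 2 powr ((real n - 1) / 2) * max_sd n {{1..n}} f"
proof -
  obtain x where x: "x \<in> cube {1..n}" "f x = sup_norm n f"
    using odd_fun_attains_sup_norm[OF odd] by blast
  let ?x = "\<lambda>i\<in>{1..n}. - x i"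
  \<comment> \<open>The only point of \<open>cube {}\<close>.\<close>
  let ?b = "(\<lambda>_. undefined) :: nat \<Rightarrow> real"
  have b: "?b \<in> cube ({1..n} - {1..n})" by (simp add: cube_def)
  have x': "?x \<in> cube {1..n}" "f ?x = - f x"
    using x cube_neg odd unfolding odd_fun_def by blast+
  have "?x 1 \<noteq> x 1" using n x cube_cases[of x "{1..n}" 1] by auto
  then have "?x \<noteq> x" by metis
  have "(2::real) powr (real n - 1) * 2 = 2 ^ n"
    by (simp add: powr_diff powr_realpow)
  have "cube_avg {1..n} (restr n f {1..n} ?b) = 0"
    using block_avg_full[OF odd] by (simp add: block_avg_def)
  then have "cube_var {1..n} (restr n f {1..n} ?b) = cube_avg {1..n} (\<lambda>y. (f y)\<^sup>2)"
    unfolding cube_var_eq[OF finite_atLeastAtMost]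
    by (intro cube_avg_cong) (use restr_full[of _ n f] in simp)
  moreover have "(\<Sum>y\<in>{x, ?x}. (f y)\<^sup>2) \<le> (\<Sum>y\<in>cube {1..n}. (f y)\<^sup>2)"
    using x x' by (intro sum_mono2) auto
  then have "2 * (f x)\<^sup>2 / 2 ^ n \<le> cube_avg {1..n} (\<lambda>y. (f y)\<^sup>2)"
    using \<open>?x \<noteq> x\<close> x' unfolding cube_avg_def by (intro divide_mono) auto
  ultimately have "(f x)\<^sup>2 \<le> 2 powr (real n - 1) * cube_var {1..n} (restr n f {1..n} ?b)"
    using \<open>2 powr (real n - 1) * 2 = 2 ^ n\<close> by (simp add: field_simps flip: \<open>2 powr (real n - 1) * 2 = 2 ^ n\<close>)
  then have "f x \<le> sqrt (2 powr (real n - 1) * cube_var {1..n} (restr n f {1..n} ?b))"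
    by (rule real_le_rsqrt)
  also have "\<dots> = 2 powr ((real n - 1) / 2) * sqrt (cube_var {1..n} (restr n f {1..n} ?b))"
    by (simp add: real_sqrt_mult powr_half_sqrt_powr)
  also have "\<dots> \<le> 2 powr ((real n - 1) / 2) * max_sd n {{1..n}} f"
    using b by (intro mult_left_mono max_sd_ge) auto
  finally show ?thesis using x by simp
qed


section \<open>Bounded-size sets\<close>

lemma ones_cube: "(\<lambda>i\<in>S. 1) \<in> cube S"
  by (simp add: cube_def)

text \<open>A restriction of the coordinate sum is a constant plus \<open>card S\<close> independent
  signs, with variance at most \<open>k\<close>, while the sum at the all-ones point is
  \<open>n\<close>.\<close>

lemma val_bounded_sets:
  assumes k: "1 \<le> k" "k \<le> n"
  defines "Q \<equiv> {S. S \<subseteq> {1..n} \<and> card S \<le> k}"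
  shows "real n / sqrt (real k) \<le> val n Q \<and> val n Q \<le> 3 * (real n / sqrt (real k))"
proof (rule val_bounds[where ?f0.0 = "\<lambda>x. \<Sum>i=1..n. x i" and ?x0.0 = "\<lambda>i\<in>{1..n}. 1"])
  show "finite Q" unfolding Q_def by (rule finite_subset[of _ "Pow {1..n}"]) auto
  show "Q \<noteq> {}" unfolding Q_def by (auto intro: exI[of _ "{}"])
  show "odd_fun n (\<lambda>x. \<Sum>i=1..n. x i)"
    by (simp add: odd_fun_def sum_negf)
  show "sup_norm n f \<le> 3 * (real n / sqrt (real k)) * max_sd n Q f" if "odd_fun n f" for f
    unfolding Q_def using sup_norm_le_bounded_sets[OF that k] .
  fix S b assume "S \<in> Q" "b \<in> cube ({1..n} - S)"
  then have S: "S \<subseteq> {1..n}" "card S \<le> k" "finite S"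
    using finite_subset by (auto simp: Q_def)
  let ?h = "restr n (\<lambda>x. \<Sum>i=1..n. x i) S b"
  have "?h y - (\<Sum>i\<in>{1..n} - S. b i) = (\<Sum>i\<in>S. 1 * y i)" for y
  proof -
    have "(\<Sum>i\<in>{1..n} - S. merge S ({1..n} - S) (y, b) i) = (\<Sum>i\<in>{1..n} - S. b i)"
      by (intro sum.cong) (auto simp: merge_def)
    then show ?thesis
      unfolding restr_def sum.subset_diff[OF S(1) finite_atLeastAtMost]
      by (simp add: merge_def)
  qed
  then have "cube_var S ?h \<le> cube_avg S (\<lambda>y. (\<Sum>i\<in>S. 1 * y i)\<^sup>2)"
    using cube_var_le[OF S(3), of ?h "\<Sum>i\<in>{1..n} - S. b i"] by simp
  also have "\<dots> = card S" using S by (intro cube_avg_linear_sq) auto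
  finally show "cube_var S ?h \<le> (sqrt (real k))\<^sup>2" using S(2) by simp
qed (use k ones_cube in \<open>auto simp: Q_def\<close>)

section \<open>Prefixes and final runs\<close>

text \<open>Length of the block of consecutive entries \<open>e\<close> that ends at position
  \<open>i\<close>, counted backwards and stopping at position 1.\<close>

primrec run :: "real \<Rightarrow> nat \<Rightarrow> (nat \<Rightarrow> real) \<Rightarrow> real" where
  "run e 0 x = 0"
| "run e (Suc i) x = (if x (Suc i) = e then 1 + run e i x else 0)"

lemma run_cong: "(\<And>j. 1 \<le> j \<Longrightarrow> j \<le> i \<Longrightarrow> x j = y j) \<Longrightarrow> run e i x = run e i y"
  by (induction i) auto

lemma run_const: "run e i (\<lambda>j\<in>{1..i}. e) = real i"
proof -
  have "run e j (\<lambda>j\<in>{1..i}. e) = real j" if "j \<le> i" for j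
    using that by (induction j) auto
  then show ?thesis by simp
qed

lemma run_uminus:
  assumes "i \<le> n"
  shows "run (- e) i (\<lambda>j\<in>{1..n}. - x j) = run e i x"
  using assms by (induction i) auto

text \<open>A new last coordinate equals \<open>e\<close> with probability 1/2, so moments
  \<open>p\<close>, \<open>q\<close> become \<open>(1 + p) / 2\<close> and
  \<open>(1 + 2 * p + q) / 2\<close>. The bounds 1 and 3 are the fixed point of this
  recursion.\<close>

lemma run_moments:
  assumes "e = 1 \<or> e = -1"
  shows "cube_avg {1..i} (run e i) \<le> 1 \<and> cube_avg {1..i} (\<lambda>y. (run e i y)\<^sup>2) \<le> 3"
proof (induction i)
  case (Suc i)
  have *: "{1..Suc i} = insert (Suc i) {1..i}" by auto
  have upd: "run e i (y(Suc i := c)) = run e i y" for e y c by (rule run_cong) auto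
  have "cube_avg {1..Suc i} (run e (Suc i)) = cube_avg {1..i} (\<lambda>y. 1 / 2 * (1 + run e i y))"
    unfolding * using assms by (subst cube_avg_insert) (auto simp: upd)
  moreover have "cube_avg {1..Suc i} (\<lambda>y. (run e (Suc i) y)\<^sup>2) =
      cube_avg {1..i} (\<lambda>y. 1 / 2 * (1 + (2 * run e i y + (run e i y)\<^sup>2)))"
    unfolding * using assms
    by (subst cube_avg_insert)
      (auto simp: upd power2_eq_square field_simps intro!: cube_avg_cong)
  ultimately show ?case
    using Suc by (simp only: cube_avg_cmult cube_avg_add cube_avg_const[OF finite_atLeastAtMost]) simp
qed (simp add: cube_avg_def)

text \<open>Either the fixed coordinates break the run, and then its length is constant, or they all
  equal \<open>e\<close> and prolong the run ending at \<open>i\<close> by a constant. Both cases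
  are affine with slope of modulus at most 1.\<close>

lemma run_restriction:
  assumes "i \<le> n"
  shows "\<exists>c d. \<bar>d\<bar> \<le> 1 \<and> (\<forall>x. (\<forall>j\<in>{Suc i..n}. x j = b j) \<longrightarrow> run e n x = c + d * run e i x)"
  using assms
proof (induction n rule: dec_induct)
  case base
  then show ?case by (intro exI[of _ 0] exI[of _ 1]) auto
next
  case (step n)
  then obtain c d where cd: "\<bar>d\<bar> \<le> 1"
    "\<And>x. \<forall>j\<in>{Suc i..n}. x j = b j \<Longrightarrow> run e n x = c + d * run e i x" by blast
  show ?case
  proof (cases "b (Suc n) = e")
    case True
    then show ?thesis using cd step by (intro exI[of _ "1 + c"] exI[of _ d]) auto
  next
    case False
    then show ?thesis using step by (intro exI[of _ 0]) auto
  qed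
qed

lemma val_prefixes:
  assumes n: "1 \<le> n"
  defines "Q \<equiv> {{1..i} | i. i \<in> {1..n}}"
  shows "real n / 3 \<le> val n Q \<and> val n Q \<le> real n"
proof (rule val_bounds[where ?f0.0 = "\<lambda>x. x n * run (x n) n x" and ?x0.0 = "\<lambda>i\<in>{1..n}. 1"])
  let ?f = "\<lambda>x. x n * run (x n) n x"
  show "Q \<noteq> {}" unfolding Q_def using n by auto
  show "odd_fun n ?f"
    unfolding odd_fun_def using n run_uminus[of n n] by simp
  show "sup_norm n f \<le> real n * max_sd n Q f" if "odd_fun n f" for f
    unfolding Q_def using sup_norm_le_prefixes[OF that n] .
  show "real n \<le> ?f (\<lambda>i\<in>{1..n}. 1)" using n run_const[of 1 n] by simp
  fix S b assume "S \<in> Q" and b: "b \<in> cube ({1..n} - S)"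
  then obtain i where i: "S = {1..i}" "1 \<le> i" "i \<le> n" by (auto simp: Q_def)
  have sq: "cube_avg S (\<lambda>y. (run e i y)\<^sup>2) \<le> 3" if "e = 1 \<or> e = -1" for e
    using run_moments[OF that] i by blast
  \<comment> \<open>The bound is \<open>3 + 3\<close>, needed when \<open>i = n\<close> and the sign
    of the final run is still free. It lies below \<open>3\<^sup>2\<close>, whence the constant
    1/3.\<close>
  have "\<exists>c. cube_avg S (\<lambda>y. (restr n ?f S b y - c)\<^sup>2) \<le> 6"
  proof (cases "i = n")
    case True
    have "cube_avg S (\<lambda>y. (restr n ?f S b y - 0)\<^sup>2) \<le>
        cube_avg S (\<lambda>y. (run 1 n y)\<^sup>2 + (run (-1) n y)\<^sup>2)"
    proof (intro cube_avg_mono)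
      fix y assume "y \<in> cube S"
      then show "(restr n ?f S b y - 0)\<^sup>2 \<le> (run 1 n y)\<^sup>2 + (run (-1) n y)\<^sup>2"
        using cube_cases[of y S n] restr_full[of y n ?f b] True i by auto
    qed
    also have "\<dots> \<le> 6" using sq[of 1] sq[of "-1"] True by (simp add: cube_avg_add)
    finally show ?thesis by blast
  next
    case False
    \<comment> \<open>For \<open>i < n\<close> the last coordinate is fixed by \<open>b\<close>, and
      with it the sign of the final run.\<close>
    define e where "e = b n"
    have e: "e = 1 \<or> e = -1"
      using cube_cases[OF b, of n] False i by (auto simp: e_def)
    obtain c d where cd: "\<bar>d\<bar> \<le> 1"
      "\<And>x. \<forall>j\<in>{Suc i..n}. x j = b j \<Longrightarrow> run e n x = c + d * run e i x"
      using run_restriction[OF i(3)] by meson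
    have "restr n ?f S b y = e * (c + d * run e i y)" for y
    proof -
      let ?x = "merge S ({1..n} - S) (y, b)"
      have "?x n = e" using False i by (simp add: merge_def e_def)
      moreover have "run e n ?x = c + d * run e i ?x"
        using i by (intro cd(2)) (auto simp: merge_def)
      moreover have "run e i ?x = run e i y"
        using i by (intro run_cong) (simp add: merge_def)
      ultimately show ?thesis by (simp add: restr_def)
    qed
    then have "cube_avg S (\<lambda>y. (restr n ?f S b y - e * c)\<^sup>2) \<le> cube_avg S (\<lambda>y. (run e i y)\<^sup>2)"
      using e cd(1)
      by (intro cube_avg_mono)
        (auto simp: algebra_simps power_mult_distrib abs_square_le_1 intro!: mult_left_le_one_le)
    also have "\<dots> \<le> 6" using sq[OF e] by simp
    finally show ?thesis by blast
  qed
  then obtain c where "cube_avg S (\<lambda>y. (restr n ?f S b y - c)\<^sup>2) \<le> 6" by blast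
  moreover have "cube_var S (restr n ?f S b) \<le> cube_avg S (\<lambda>y. (restr n ?f S b y - c)\<^sup>2)"
    using i by (intro cube_var_le) simp
  ultimately show "cube_var S (restr n ?f S b) \<le> 3\<^sup>2" by simp
qed (use n ones_cube in \<open>auto simp: Q_def\<close>)

section \<open>Constant blocks and the full set\<close>

text \<open>For empty \<open>B\<close> the two indicators cancel, which is why
  \<open>mono_sign_ones\<close> asks for a nonempty set.\<close>

definition mono_sign :: "nat set \<Rightarrow> (nat \<Rightarrow> real) \<Rightarrow> real" where
  "mono_sign B x = of_bool (\<forall>i\<in>B. x i = 1) - of_bool (\<forall>i\<in>B. x i = -1)"

lemma mono_sign_cong: "(\<And>i. i \<in> B \<Longrightarrow> x i = y i) \<Longrightarrow> mono_sign B x = mono_sign B y"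
  by (simp add: mono_sign_def)

lemma mono_sign_uminus: "B \<subseteq> A \<Longrightarrow> mono_sign B (\<lambda>i\<in>A. - x i) = - mono_sign B x"
proof -
  assume "B \<subseteq> A"
  then have "mono_sign B (\<lambda>i\<in>A. - x i) = mono_sign B (\<lambda>i. - x i)"
    by (intro mono_sign_cong) auto
  moreover have "- x i = 1 \<longleftrightarrow> x i = -1" for i by linarith
  ultimately show ?thesis by (simp add: mono_sign_def)
qed

lemma abs_mono_sign_le: "\<bar>mono_sign B x\<bar> \<le> 1"
  by (simp add: mono_sign_def)

lemma mono_sign_ones: "B \<noteq> {} \<Longrightarrow> B \<subseteq> A \<Longrightarrow> mono_sign B (\<lambda>i\<in>A. 1) = 1"
  by (auto simp: mono_sign_def)

text \<open>Splitting off the coordinates outside \<open>B\<close> leaves an average over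
  \<open>cube B\<close>, where exactly one point qualifies.\<close>

lemma cube_avg_const_on:
  assumes "finite S" "B \<subseteq> S" "e = 1 \<or> e = -1"
  shows "cube_avg S (\<lambda>y. of_bool (\<forall>i\<in>B. y i = e)) = 1 / 2 ^ card B"
proof -
  have "finite B" using assms finite_subset by blast
  have eq: "(\<forall>i\<in>B. w i = e) \<longleftrightarrow> w = (\<lambda>i\<in>B. e)" if "w \<in> cube B" for w
    using that by (auto simp: cube_def PiE_iff extensional_def fun_eq_iff)
  have e: "(\<lambda>i\<in>B. e) \<in> cube B" using assms by (auto simp: cube_def)
  have "(\<Sum>w\<in>cube B. of_bool (\<forall>i\<in>B. w i = e) :: real) =
      (\<Sum>w\<in>cube B. if w = (\<lambda>i\<in>B. e) then 1 else 0)"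
    using eq by (intro sum.cong) auto
  also have "\<dots> = 1" using e \<open>finite B\<close> by simp
  finally have "cube_avg B (\<lambda>w. of_bool (\<forall>i\<in>B. w i = e)) = 1 / 2 ^ card B"
    by (simp add: cube_avg_def)
  then show ?thesis
    using assms by (subst cube_avg_split[OF assms(1,2)]) (simp add: merge_def)
qed

lemma cube_avg_mono_sign_sq:
  assumes "finite S" "B \<subseteq> S"
  shows "cube_avg S (\<lambda>y. (mono_sign B y)\<^sup>2) \<le> 2 / 2 ^ card B"
proof -
  have "cube_avg S (\<lambda>y. (mono_sign B y)\<^sup>2) \<le>
      cube_avg S (\<lambda>y. of_bool (\<forall>i\<in>B. y i = 1) + of_bool (\<forall>i\<in>B. y i = -1))"
    by (intro cube_avg_mono) (simp add: mono_sign_def)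
  also have "\<dots> = 2 / 2 ^ card B"
    using assms by (simp add: cube_avg_add cube_avg_const_on)
  finally show ?thesis .
qed

text \<open>\<open>mono_sign {1..n}\<close> lives on one antipodal pair, the case in which the
  estimate behind \<open>sup_norm_le_full\<close> loses nothing; so the two bounds coincide.\<close>

lemma val_full:
  assumes n: "1 \<le> n"
  shows "val n {{1..n}} = 2 powr ((real n - 1) / 2)"
proof -
  let ?s = "sqrt (2 / 2 ^ n)"
  have "1 / ?s \<le> val n {{1..n}} \<and> val n {{1..n}} \<le> 2 powr ((real n - 1) / 2)"
  proof (rule val_bounds[where ?f0.0 = "mono_sign {1..n}" and ?x0.0 = "\<lambda>i\<in>{1..n}. 1"])
    show "sup_norm n f \<le> 2 powr ((real n - 1) / 2) * max_sd n {{1..n}} f" if "odd_fun n f" for f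
      using sup_norm_le_full[OF that n] .
    fix S b assume "S \<in> {{1..n}}"
    then have S: "S = {1..n}" by simp
    have "cube_var S (restr n (mono_sign {1..n}) S b) \<le>
        cube_avg S (\<lambda>y. (restr n (mono_sign {1..n}) S b y - 0)\<^sup>2)"
      using S by (intro cube_var_le) simp
    also have "\<dots> = cube_avg S (\<lambda>y. (mono_sign {1..n} y)\<^sup>2)"
      unfolding S by (intro cube_avg_cong) (use restr_full[of _ n "mono_sign {1..n}"] in simp)
    also have "\<dots> \<le> 2 / 2 ^ n"
      using cube_avg_mono_sign_sq[of S "{1..n}"] S by simp
    finally show "cube_var S (restr n (mono_sign {1..n}) S b) \<le> ?s\<^sup>2" by simp
  qed (use n ones_cube in \<open>auto simp: odd_fun_def mono_sign_uminus mono_sign_ones\<close>)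
  moreover have "1 / ?s = 2 powr ((real n - 1) / 2)"
  proof -
    have "(2::real) powr (real n - 1) = 1 / (2 / 2 ^ n)" by (simp add: powr_diff powr_realpow)
    moreover have "2 powr ((real n - 1) / 2) = sqrt (2 powr (real n - 1))"
      by (rule powr_half_sqrt_powr) simp
    moreover have "sqrt (1 / (2 / 2 ^ n)) = 1 / ?s"
      by (simp only: real_sqrt_divide[of 1 "2 / 2 ^ n"] real_sqrt_one)
    ultimately show ?thesis by metis
  qed
  ultimately show ?thesis by linarith
qed

section \<open>Intervals\<close>

text \<open>Blocks disjoint from the interval (\<open>T0\<close>) contribute a constant, blocks cut
  by it (\<open>T2\<close>) a bounded amount, and blocks inside it (\<open>T1\<close>) are rarely
  constant since \<open>2 ^ l\<close> is at least \<open>n ^ 2\<close>.\<close>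

lemma cube_var_blocks_le:
  fixes l n :: nat
  assumes l: "1 \<le> l" "n ^ 2 \<le> 2 ^ l" and ij: "1 \<le> i" "i \<le> j" "j \<le> n"
    and b: "b \<in> cube ({1..n} - {i..j})"
  defines "B \<equiv> \<lambda>t. {t * l + 1..t * l + l}"
  defines "f \<equiv> \<lambda>x. x 1 + (\<Sum>t<n div l. mono_sign (B t) x)"
  shows "cube_var {i..j} (restr n f {i..j} b) \<le> 5\<^sup>2"
proof -
  let ?S = "{i..j}"
  define T0 where "T0 = {t. t < n div l \<and> B t \<inter> ?S = {}}"
  define T1 where "T1 = {t. t < n div l \<and> B t \<subseteq> ?S}"
  define T2 where "T2 = {t. t < n div l \<and> B t \<inter> ?S \<noteq> {} \<and> \<not> B t \<subseteq> ?S}"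
  have fin: "finite T0" "finite T1" "finite T2"
    unfolding T0_def T1_def T2_def by simp_all
  have Bne: "B t \<noteq> {}" for t using l by (simp add: B_def)
  have T: "{..<n div l} = T0 \<union> (T1 \<union> T2)" "T0 \<inter> (T1 \<union> T2) = {}" "T1 \<inter> T2 = {}"
    using Bne unfolding T0_def T1_def T2_def by blast+
  \<comment> \<open>A cut block contains \<open>i\<close> or \<open>j\<close>. Blocks start at
    \<open>t * l + 1\<close>, so the block containing \<open>i\<close> has index
    \<open>(i - 1) div l\<close>.\<close>
  have "T2 \<subseteq> {(i - 1) div l, (j - 1) div l}"
  proof
    fix t assume "t \<in> T2"
    then obtain p q where pq: "p \<in> B t" "p \<in> ?S" "q \<in> B t" "q \<notin> ?S" unfolding T2_def by blast
    show "t \<in> {(i - 1) div l, (j - 1) div l}"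
    proof (cases "q < i")
      case True
      then have "(i - 1) div l = t"
        using pq by (intro div_nat_eqI) (auto simp: B_def algebra_simps)
      then show ?thesis by simp
    next
      case False
      then have "(j - 1) div l = t"
        using pq by (intro div_nat_eqI) (auto simp: B_def algebra_simps)
      then show ?thesis by simp
    qed
  qed
  then have "card T2 \<le> card {(i - 1) div l, (j - 1) div l}" by (intro card_mono) auto
  also have "\<dots> \<le> 2" by (simp add: card_insert_if)
  finally have T2: "card T2 \<le> 2" .
  have "card T1 \<le> card {..<n div l}" unfolding T1_def by (intro card_mono) auto
  also have "\<dots> \<le> n" by (simp add: div_le_dividend)
  finally have T1: "card T1 \<le> n" .
  have Bn: "B t \<subseteq> {1..n}" if "t < n div l" for t
  proof -
    have "Suc t * l \<le> n div l * l" using that by (intro mult_right_mono) auto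
    also have "\<dots> \<le> n" by simp
    finally show ?thesis by (auto simp: B_def)
  qed
  let ?c = "\<Sum>t\<in>T0. mono_sign (B t) b"
  let ?s = "\<lambda>y. \<Sum>t\<in>T1. mono_sign (B t) y"
  have "cube_var ?S (restr n f ?S b) \<le> cube_avg ?S (\<lambda>y. (restr n f ?S b y - ?c)\<^sup>2)"
    by (rule cube_var_le) simp
  \<comment> \<open>The coordinate \<open>x 1\<close> and at most two cut blocks sum to at most 3 in
    absolute value, so \<open>(u + v)\<^sup>2 \<le> 2 * u\<^sup>2 + 2 * v\<^sup>2\<close> gives
    \<open>18 = 2 * 3\<^sup>2\<close>. The inner blocks are handled by Cauchy-Schwarz.\<close>
  also have "\<dots> \<le> cube_avg ?S (\<lambda>y. 18 + 2 * (real n * (\<Sum>t\<in>T1. (mono_sign (B t) y)\<^sup>2)))"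
  proof (rule cube_avg_mono)
    fix y assume y: "y \<in> cube ?S"
    let ?x = "merge ?S ({1..n} - ?S) (y, b)"
    have "?x \<in> cube {1..n}" using y b ij by (intro merge_restr_cube) auto
    then have x1: "\<bar>?x 1\<bar> \<le> 1" using cube_cases[of ?x "{1..n}" 1] ij by auto
    have "(\<Sum>t\<in>T0. mono_sign (B t) ?x) = ?c"
      using Bn by (intro sum.cong mono_sign_cong refl) (force simp: T0_def merge_def)
    moreover have "(\<Sum>t\<in>T1. mono_sign (B t) ?x) = ?s y"
      by (intro sum.cong mono_sign_cong refl) (auto simp: T1_def merge_def)
    ultimately have eq: "restr n f ?S b y - ?c = (?x 1 + (\<Sum>t\<in>T2. mono_sign (B t) ?x)) + ?s y"
      unfolding restr_def f_def T(1) using fin T by (simp add: sum.union_disjoint)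
    have "\<bar>\<Sum>t\<in>T2. mono_sign (B t) ?x\<bar> \<le> (\<Sum>t\<in>T2. 1)"
      by (intro order_trans[OF sum_abs] sum_mono abs_mono_sign_le)
    then have "\<bar>?x 1 + (\<Sum>t\<in>T2. mono_sign (B t) ?x)\<bar> \<le> 3"
      using x1 T2 by simp
    then have "(?x 1 + (\<Sum>t\<in>T2. mono_sign (B t) ?x))\<^sup>2 \<le> 9"
      using power_mono[OF _ abs_ge_zero, of _ "3 :: real" 2] by simp
    moreover have "(u + v)\<^sup>2 \<le> 2 * u\<^sup>2 + 2 * v\<^sup>2" for u v :: real
      using zero_le_power2[of "u - v"] by (simp add: power2_eq_square algebra_simps)
    from this[of "?x 1 + (\<Sum>t\<in>T2. mono_sign (B t) ?x)" "?s y"]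
    have "(restr n f ?S b y - ?c)\<^sup>2 \<le>
        2 * (?x 1 + (\<Sum>t\<in>T2. mono_sign (B t) ?x))\<^sup>2 + 2 * (?s y)\<^sup>2"
      unfolding eq .
    ultimately have "(restr n f ?S b y - ?c)\<^sup>2 \<le> 18 + 2 * (?s y)\<^sup>2"
      by linarith
    moreover have "(?s y)\<^sup>2 \<le> real n * (\<Sum>t\<in>T1. (mono_sign (B t) y)\<^sup>2)"
    proof -
      have "(?s y)\<^sup>2 \<le> real (card T1) * (\<Sum>t\<in>T1. (mono_sign (B t) y)\<^sup>2)"
        using Cauchy_Schwarz_ineq_sum[of "\<lambda>_. 1" "\<lambda>t. mono_sign (B t) y" T1] by simp
      also have "\<dots> \<le> real n * (\<Sum>t\<in>T1. (mono_sign (B t) y)\<^sup>2)"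
        using T1 by (intro mult_right_mono sum_nonneg) auto
      finally show ?thesis .
    qed
    ultimately show "(restr n f ?S b y - ?c)\<^sup>2 \<le>
        18 + 2 * (real n * (\<Sum>t\<in>T1. (mono_sign (B t) y)\<^sup>2))" by linarith
  qed
  also have "\<dots> = 18 + 2 * (real n * (\<Sum>t\<in>T1. cube_avg ?S (\<lambda>y. (mono_sign (B t) y)\<^sup>2)))"
    by (simp only: cube_avg_add cube_avg_cmult cube_avg_sum cube_avg_const[OF finite_atLeastAtMost])
  also have "\<dots> \<le> 18 + 2 * (real n * (\<Sum>t\<in>T1. 2 / 2 ^ l))"
  proof (intro add_left_mono mult_left_mono sum_mono)
    fix t assume "t \<in> T1"
    then show "cube_avg ?S (\<lambda>y. (mono_sign (B t) y)\<^sup>2) \<le> 2 / 2 ^ l"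
      using cube_avg_mono_sign_sq[of ?S "B t"] by (simp add: T1_def B_def)
  qed auto
  also have "\<dots> \<le> 18 + 2 * (real n * (real n * (2 / 2 ^ l)))"
    using T1 by (auto intro!: mult_left_mono divide_right_mono)
  also have "\<dots> = 18 + 4 * (real (n ^ 2) / 2 ^ l)" by (simp add: power2_eq_square)
  \<comment> \<open>The total is at most \<open>18 + 4 = 22\<close>, below
    \<open>5\<^sup>2\<close>.\<close>
  also have "real (n ^ 2) / 2 ^ l \<le> 1"
    using l(2) of_nat_mono[OF l(2), where ?'a = real] by simp
  finally show ?thesis by simp
qed

lemma val_intervals:
  assumes n: "1 \<le> n"
  defines "Q \<equiv> {{i..j} | i j. i \<in> {1..n} \<and> j \<in> {1..n} \<and> i \<le> j}"
  shows "real n / (20 * (1 + ln (real n))) \<le> val n Q \<and> val n Q \<le> real n"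
proof -
  \<comment> \<open>Least order of length with \<open>n ^ 2 \<le> 2 ^ l\<close>; the added 1 keeps
    \<open>l\<close> positive for \<open>n = 1\<close>.\<close>
  define l where "l = nat \<lceil>2 * log 2 (real n)\<rceil> + 1"
  have log: "0 \<le> log 2 (real n)" using n by simp
  have l1: "1 \<le> l" by (simp add: l_def)
  have "2 * log 2 (real n) \<le> real l" unfolding l_def using log by linarith
  then have "2 powr (2 * log 2 (real n)) \<le> 2 powr (real l)" by simp
  moreover have "2 powr (2 * log 2 (real n)) = (real n)\<^sup>2"
    using n powr_powr[of 2 "log 2 (real n)" 2] by (simp add: mult.commute)
  ultimately have "real (n ^ 2) \<le> real (2 ^ l)" by (simp add: powr_realpow)
  then have l2: "n ^ 2 \<le> 2 ^ l" by (simp only: of_nat_le_iff)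
  have "log 2 (real n) \<le> 3 / 2 * ln (real n)"
  proof -
    have "ln (real n) * 1 \<le> ln (real n) * (3 / 2 * ln 2)"
      using n ln2_ge_two_thirds by (intro mult_left_mono) auto
    then show ?thesis by (simp add: log_def field_simps)
  qed
  moreover have "real l \<le> 2 * log 2 (real n) + 2" unfolding l_def using log by linarith
  moreover have ln: "0 \<le> ln (real n)" using n by simp
  ultimately have l3: "real l \<le> 4 * (1 + ln (real n))" by simp
  define f where "f x = x 1 + (\<Sum>t<n div l. mono_sign {t * l + 1..t * l + l} x)" for x
  \<comment> \<open>The 4 comes from \<open>l \<le> 4 * (1 + ln n)\<close>; dividing by the standard
    deviation bound 5 produces the 20 of the statement.\<close>
  let ?m = "real n / (4 * (1 + ln (real n)))"
  have sub: "{t * l + 1..t * l + l} \<subseteq> {1..n}" if "t < n div l" for t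
  proof -
    have "Suc t * l \<le> n div l * l" using that by (intro mult_right_mono) auto
    also have "\<dots> \<le> n" by simp
    finally show ?thesis by auto
  qed
  have fin: "finite Q" unfolding Q_def by (rule finite_subset[of _ "Pow {1..n}"]) auto
  have "?m / 5 \<le> val n Q \<and> val n Q \<le> real n"
  proof (rule val_bounds[where ?f0.0 = f and ?x0.0 = "\<lambda>i\<in>{1..n}. 1", OF fin])
    show "Q \<noteq> {}" using n by (auto simp: Q_def)
    show "sup_norm n g \<le> real n * max_sd n Q g" if "odd_fun n g" for g
    proof -
      let ?P = "{{1..i} | i. i \<in> {1..n}}"
      have "sup_norm n g \<le> real n * max_sd n ?P g" by (rule sup_norm_le_prefixes[OF that n])
      also have "\<dots> \<le> real n * max_sd n Q g"
        using n by (intro mult_left_mono max_sd_mono fin) (auto simp: Q_def)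
      finally show ?thesis .
    qed
    show "odd_fun n f"
      unfolding odd_fun_def f_def using n sub by (simp add: mono_sign_uminus sum_negf)
    have "?m \<le> real n / real l" using l1 l3 ln by (intro divide_left_mono) auto
    \<comment> \<open>The summand \<open>x 1\<close> of \<open>f\<close> supplies the 1, which
      absorbs the rounding in \<open>n div l\<close> and keeps \<open>f\<close> nonzero when
      \<open>n < l\<close>.\<close>
    also have "\<dots> \<le> 1 + real (n div l)"
    proof -
      have "n \<le> (1 + n div l) * l" using l1 dividend_less_times_div[of l n] by (simp add: algebra_simps)
      then have "real n \<le> (1 + real (n div l)) * real l"
        by (metis of_nat_1 of_nat_add of_nat_le_iff of_nat_mult)
      then show ?thesis using l1 by (simp add: pos_divide_le_eq)
    qed
    also have "\<dots> = f (\<lambda>i\<in>{1..n}. 1)"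
      unfolding f_def using n sub l1 by (simp add: mono_sign_ones)
    finally show "?m \<le> f (\<lambda>i\<in>{1..n}. 1)" .
    show "cube_var S (restr n f S b) \<le> 5\<^sup>2" if "S \<in> Q" "b \<in> cube ({1..n} - S)" for S b
      using that cube_var_blocks_le[OF l1 l2] unfolding Q_def f_def by auto
    show "0 < ?m" using n ln by (intro divide_pos_pos mult_pos_pos add_pos_nonneg) auto
  qed (use n ones_cube in \<open>auto simp: Q_def\<close>)
  then show ?thesis by simp
qed

text \<open>The polylogarithmic factor is a power of \<open>1 + ln n\<close>, which is at least 1
  even for \<open>n = 1\<close>.\<close>

theorem theorem1p2:
  shows
    "(\<exists>c>0. \<exists>C>0. \<forall>n k :: nat. 1 \<le> k \<and> k \<le> n \<longrightarrow>
        (let v = val n {S. S \<subseteq> {1..n} \<and> card S \<le> k}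
         in c * (real n / sqrt (real k)) \<le> v \<and> v \<le> C * (real n / sqrt (real k)))) \<and>
     (\<exists>c>0. \<exists>C>0. \<exists>a :: nat. \<forall>n :: nat. 1 \<le> n \<longrightarrow>
        (let v = val n {{i..j} | i j. i \<in> {1..n} \<and> j \<in> {1..n} \<and> i \<le> j}
         in c * real n / (1 + ln (real n)) ^ a \<le> v \<and> v \<le> C * real n * (1 + ln (real n)) ^ a)) \<and>
     (\<exists>c>0. \<exists>C>0. \<forall>n :: nat. 1 \<le> n \<longrightarrow>
        (let v = val n {{1..i} | i. i \<in> {1..n}}
         in c * real n \<le> v \<and> v \<le> C * real n)) \<and>
     (\<forall>n :: nat. 1 \<le> n \<longrightarrow> val n {{1..n}} = 2 powr ((real n - 1) / 2))"
proof (intro conjI)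
  show "\<exists>c>0. \<exists>C>0. \<forall>n k :: nat. 1 \<le> k \<and> k \<le> n \<longrightarrow>
        (let v = val n {S. S \<subseteq> {1..n} \<and> card S \<le> k}
         in c * (real n / sqrt (real k)) \<le> v \<and> v \<le> C * (real n / sqrt (real k)))"
    using val_bounded_sets
    by (intro exI[of _ "1 :: real"] exI[of _ "3 :: real"] conjI) (auto simp: Let_def)
  show "\<exists>c>0. \<exists>C>0. \<exists>a :: nat. \<forall>n :: nat. 1 \<le> n \<longrightarrow>
        (let v = val n {{i..j} | i j. i \<in> {1..n} \<and> j \<in> {1..n} \<and> i \<le> j}
         in c * real n / (1 + ln (real n)) ^ a \<le> v \<and> v \<le> C * real n * (1 + ln (real n)) ^ a)"
  proof (rule exI[of _ "1 / 20 :: real"], intro conjI, simp, rule exI[of _ "1 :: real"],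
      intro conjI, simp, intro exI[of _ 1] allI impI)
    fix n :: nat assume n: "1 \<le> n"
    let ?v = "val n {{i..j} | i j. i \<in> {1..n} \<and> j \<in> {1..n} \<and> i \<le> j}"
    \<comment> \<open>Exponent 1 serves both sides: the lower bound loses one logarithm, and the
      upper bound \<open>n\<close> is merely weakened by a factor of at least 1.\<close>
    have "real n * 1 \<le> real n * (1 + ln (real n))" using n by (intro mult_left_mono) auto
    then show "let v = ?v in 1 / 20 * real n / (1 + ln (real n)) ^ 1 \<le> v \<and>
        v \<le> 1 * real n * (1 + ln (real n)) ^ 1"
      using val_intervals[OF n] by (simp add: Let_def mult.commute)
  qed
  show "\<exists>c>0. \<exists>C>0. \<forall>n :: nat. 1 \<le> n \<longrightarrow>
        (let v = val n {{1..i} | i. i \<in> {1..n}} in c * real n \<le> v \<and> v \<le> C * real n)"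
    using val_prefixes
    by (intro exI[of _ "1 / 3 :: real"] exI[of _ "1 :: real"] conjI) (auto simp: Let_def)
  show "\<forall>n :: nat. 1 \<le> n \<longrightarrow> val n {{1..n}} = 2 powr ((real n - 1) / 2)"
    using val_full by blast
qed

end
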